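(* Let $p$ be a prime and let $G_{p,1}=C_p\wr C$ be the restricted wreath product, where $C_p=\langle a\rangle$ is cyclic of order $p$ and $C=\langle x\rangle$ is infinite cyclic. Let $j\in\{1,\dots,p-1\}$ and let $\beta$ be the permutation of $\{0,1,\dots,p-1\}$ defined by $\beta: i\mapsto ij$ modulo $p$. Then the assignment $$\varphi: a\mapsto\alpha=(0,1,\dots,p-1),\qquad x\mapsto \xi=\left(\xi,\ \dots,\ \xi\alpha^{i},\ \dots,\ \xi\alpha^{p-1}\right)\beta$$ (where the $i$-th entry of $\xi$ is $\xi\alpha^i$ for $0\le i\le p-1$) extends to a faithful state-closed representation of $G_{p,1}$ on the $p$-ary tree.
   Context: The restricted wreath product $C_p\wr C$ is the semidirect product $A\rtimes C$ with $A=\bigoplus_{n\in\mathbb Z}\langle a^{x^n}\rangle$, where $a^{x^n}=x^{-n}ax^n$. The $p$-ary rooted tree has as vertices the finite sequences over $\{0,\dots,p-1\}$. An automorphism $g$ is written $g=(g_0,\dots,g_{p-1})\sigma$, where $\sigma$ is the permutation induced on the first level and $g$ maps the vertex $iw$ to $i^{\sigma}w^{g_i}$ (automorphisms act on the right and products are read from left to right). A permutation $\sigma$ of $\{0,\dots,p-1\}$ is identified with the automorphism $(1,\dots,1)\sigma$; in particular $\alpha$ is the cycle $(0,1,\dots,p-1)$ acting on the first letter only. The recursive equation for $\xi$ uniquely determines a tree automorphism. The states of $g$ are $g$, the $g_i$, the states of the $g_i$, and so on. A group of tree automorphisms is state-closed if it contains all states of each of its elements. A state-closed representation is a homomorphism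 into the automorphism group of the tree with state-closed image; it is faithful if injective. *)

theory Defs
  imports "HOL-Algebra.Product_Groups" "HOL-Algebra.Bij" "HOL-Computational_Algebra.Primes"
begin

section \<open>Semidirect and restricted wreath products\<close>

text \<open>The pair \<open>(u, h)\<close> stands for the product \<open>u h\<close>, and \<open>act h u\<close> for \<open>h u h\<^sup>-\<^sup>1\<close>.\<close>

definition semidirect_product ::
    "('a, 'c) monoid_scheme \<Rightarrow> ('b, 'd) monoid_scheme \<Rightarrow> ('b \<Rightarrow> 'a \<Rightarrow> 'a) \<Rightarrow> ('a \<times> 'b) monoid"
  where "semidirect_product N H act =
    \<lparr>carrier = carrier N \<times> carrier H,
     monoid.mult = (\<lambda>(u, h) (v, k). (u \<otimes>\<^bsub>N\<^esub> act h v, h \<otimes>\<^bsub>H\<^esub> k)),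
     one = (\<one>\<^bsub>N\<^esub>, \<one>\<^bsub>H\<^esub>)\<rparr>"

text \<open>A function \<open>u\<close> in the base group stands for the product over \<open>n\<close> of the conjugates
  \<open>n\<^sup>-\<^sup>1 (u n) n\<close>.  Since \<open>h (n\<^sup>-\<^sup>1 g n) h\<^sup>-\<^sup>1 = (n h\<^sup>-\<^sup>1)\<^sup>-\<^sup>1 g (n h\<^sup>-\<^sup>1)\<close>, the component of
  \<open>h u h\<^sup>-\<^sup>1\<close> at \<open>n\<close> is \<open>u (n h)\<close>.\<close>

definition restricted_wreath ::
    "('a, 'c) monoid_scheme \<Rightarrow> ('b, 'd) monoid_scheme \<Rightarrow> (('b \<Rightarrow> 'a) \<times> 'b) monoid"
  where "restricted_wreath G H =
    semidirect_product (sum_group (carrier H) (\<lambda>_. G)) H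
      (\<lambda>h u. \<lambda>n\<in>carrier H. u (n \<otimes>\<^bsub>H\<^esub> h))"

definition lamplighter :: "nat \<Rightarrow> ((int \<Rightarrow> int) \<times> int) monoid"
  where "lamplighter p = restricted_wreath (integer_mod_group p) integer_group"

definition lamp_a :: "(int \<Rightarrow> int) \<times> int"
  where "lamp_a = ((\<lambda>n. if n = 0 then 1 else 0), 0)"

definition lamp_x :: "(int \<Rightarrow> int) \<times> int"
  where "lamp_x = ((\<lambda>n. 0), 1)"


section \<open>The rooted tree and its automorphisms\<close>

definition tree_vertices :: "nat \<Rightarrow> nat list set"
  where "tree_vertices p = lists {..<p}"

definition tree_edges :: "nat \<Rightarrow> (nat list \<times> nat list) set"
  where "tree_edges p = {(w, w @ [i]) | w i. w \<in> tree_vertices p \<and> i < p}"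

text \<open>Automorphisms act on the right, so the product \<open>g h\<close> applies \<open>g\<close> first.\<close>

definition tree_aut :: "nat \<Rightarrow> (nat list \<Rightarrow> nat list) monoid"
  where "tree_aut p =
    \<lparr>carrier = {g \<in> Bij (tree_vertices p). g [] = [] \<and>
        (\<forall>v\<in>tree_vertices p. \<forall>w\<in>tree_vertices p.
           (v, w) \<in> tree_edges p \<longleftrightarrow> (g v, g w) \<in> tree_edges p)},
     monoid.mult = (\<lambda>g h. compose (tree_vertices p) h g),
     one = (\<lambda>w\<in>tree_vertices p. w)\<rparr>"

text \<open>The automorphism \<open>(g\<^sub>0, \<dots>, g\<^bsub>p-1\<^esub>)\<sigma>\<close>, where \<open>gs i\<close> is the entry \<open>g\<^sub>i\<close>.\<close>

definition wreath_aut ::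
    "nat \<Rightarrow> (nat \<Rightarrow> nat list \<Rightarrow> nat list) \<Rightarrow> (nat \<Rightarrow> nat) \<Rightarrow> nat list \<Rightarrow> nat list"
  where "wreath_aut p gs \<sigma> =
    (\<lambda>w\<in>tree_vertices p. case w of [] \<Rightarrow> [] | i # u \<Rightarrow> \<sigma> i # gs i u)"

definition rooted_aut :: "nat \<Rightarrow> (nat \<Rightarrow> nat) \<Rightarrow> nat list \<Rightarrow> nat list"
  where "rooted_aut p \<sigma> = wreath_aut p (\<lambda>i. \<one>\<^bsub>tree_aut p\<^esub>) \<sigma>"

definition section_at :: "nat \<Rightarrow> (nat list \<Rightarrow> nat list) \<Rightarrow> nat \<Rightarrow> nat list \<Rightarrow> nat list"
  where "section_at p g i = (\<lambda>w\<in>tree_vertices p. tl (g (i # w)))"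

inductive_set states :: "nat \<Rightarrow> (nat list \<Rightarrow> nat list) \<Rightarrow> (nat list \<Rightarrow> nat list) set"
  for p g where
  self: "g \<in> states p g"
| section_at: "h \<in> states p g \<Longrightarrow> i < p \<Longrightarrow> section_at p h i \<in> states p g"

definition state_closed :: "nat \<Rightarrow> (nat list \<Rightarrow> nat list) set \<Rightarrow> bool"
  where "state_closed p S \<longleftrightarrow> subgroup S (tree_aut p) \<and> (\<forall>g\<in>S. states p g \<subseteq> S)"

definition faithful_state_closed_rep ::
    "nat \<Rightarrow> ('a, 'c) monoid_scheme \<Rightarrow> ('a \<Rightarrow> nat list \<Rightarrow> nat list) \<Rightarrow> bool"
  where "faithful_state_closed_rep p G \<Phi> \<longleftrightarrow>
    \<Phi> \<in> hom G (tree_aut p) \<and> inj_on \<Phi> (carrier G) \<and> state_closed p (\<Phi> ` carrier G)"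


section \<open>The two generators\<close>

definition alpha :: "nat \<Rightarrow> nat list \<Rightarrow> nat list"
  where "alpha p = rooted_aut p (\<lambda>i. (i + 1) mod p)"

definition beta :: "nat \<Rightarrow> nat \<Rightarrow> nat \<Rightarrow> nat"
  where "beta p j i = i * j mod p"

definition xi_equation :: "nat \<Rightarrow> nat \<Rightarrow> (nat list \<Rightarrow> nat list) \<Rightarrow> bool"
  where "xi_equation p j \<xi> \<longleftrightarrow>
    \<xi> = wreath_aut p (\<lambda>i. \<xi> \<otimes>\<^bsub>tree_aut p\<^esub> alpha p [^]\<^bsub>tree_aut p\<^esub> i) (beta p j)"

text \<open>Well defined for prime \<open>p\<close> and \<open>1 \<le> j < p\<close> by \<open>ex1_xi\<close> below.\<close>

definition xi :: "nat \<Rightarrow> nat \<Rightarrow> nat list \<Rightarrow> nat list"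
  where "xi p j = (THE \<xi>. \<xi> \<in> carrier (tree_aut p) \<and> xi_equation p j \<xi>)"


section \<open>Basic facts\<close>

lemma group_lamplighter: "group (lamplighter p)"
proof -
  let ?C = "integer_mod_group p"
  interpret C: comm_group ?C by (rule abelian_integer_mod_group)
  have car: "carrier (sum_group UNIV (\<lambda>_::int. ?C)) =
      {u \<in> UNIV \<rightarrow>\<^sub>E carrier ?C. finite {n \<in> UNIV. u n \<noteq> \<one>\<^bsub>?C\<^esub>}}"
    by (rule carrier_sum_group) auto
  have fin: "finite {n::int. u (n + h) \<noteq> (0::int)}" if "finite {n. u n \<noteq> 0}" for u h
  proof -
    have "{n. u (n + h) \<noteq> 0} = (\<lambda>n. n - h) ` {n. u n \<noteq> 0}"
      by (auto simp: image_iff) (metis add_diff_cancel_right' diff_add_cancel)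
    then show ?thesis using that by simp
  qed
  have shift: "(\<lambda>n. u (n + h)) \<in> carrier (sum_group UNIV (\<lambda>_::int. ?C))"
    if "u \<in> carrier (sum_group UNIV (\<lambda>_::int. ?C))" for u h
    using that unfolding car by (auto simp: PiE_iff intro: fin)
  interpret S: group "sum_group UNIV (\<lambda>_::int. ?C)" by (rule sum_group) simp
  note defs = lamplighter_def restricted_wreath_def semidirect_product_def
  show ?thesis
  proof (rule groupI)
    show "\<one>\<^bsub>lamplighter p\<^esub> \<in> carrier (lamplighter p)"
      using S.one_closed by (simp add: defs)
  next
    fix x y assume "x \<in> carrier (lamplighter p)" "y \<in> carrier (lamplighter p)"
    then show "x \<otimes>\<^bsub>lamplighter p\<^esub> y \<in> carrier (lamplighter p)"
      using S.m_closed[OF _ shift] by (auto simp: defs)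
  next
    fix x y z
    assume "x \<in> carrier (lamplighter p)" "y \<in> carrier (lamplighter p)" "z \<in> carrier (lamplighter p)"
    then show "x \<otimes>\<^bsub>lamplighter p\<^esub> y \<otimes>\<^bsub>lamplighter p\<^esub> z
        = x \<otimes>\<^bsub>lamplighter p\<^esub> (y \<otimes>\<^bsub>lamplighter p\<^esub> z)"
      by (auto simp: defs fun_eq_iff mod_simps ac_simps)
  next
    fix x assume "x \<in> carrier (lamplighter p)"
    then show "\<one>\<^bsub>lamplighter p\<^esub> \<otimes>\<^bsub>lamplighter p\<^esub> x = x"
      using S.l_one[of "fst x"] by (auto simp: defs)
  next
    fix x assume x: "x \<in> carrier (lamplighter p)"
    obtain u h where [simp]: "x = (u, h)" by force
    have u: "u \<in> carrier (sum_group UNIV (\<lambda>_::int. ?C))" using x by (simp add: defs)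
    let ?v = "inv\<^bsub>sum_group UNIV (\<lambda>_. ?C)\<^esub> (\<lambda>n. u (n + (- h)))"
    have "?v \<in> carrier (sum_group UNIV (\<lambda>_::int. ?C))"
      by (rule S.inv_closed[OF shift[OF u]])
    moreover have "?v \<otimes>\<^bsub>sum_group UNIV (\<lambda>_. ?C)\<^esub> (\<lambda>n. u (n + (- h)))
        = \<one>\<^bsub>sum_group UNIV (\<lambda>_. ?C)\<^esub>"
      by (rule S.l_inv[OF shift[OF u]])
    ultimately show "\<exists>y\<in>carrier (lamplighter p). y \<otimes>\<^bsub>lamplighter p\<^esub> x = \<one>\<^bsub>lamplighter p\<^esub>"
      by (intro bexI[of _ "(?v, - h)"]) (auto simp: defs)
  qed
qed

lemma lamp_closed:
  assumes "1 < p"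
  shows "lamp_a \<in> carrier (lamplighter p)" "lamp_x \<in> carrier (lamplighter p)"
  using assms
  by (auto simp: lamplighter_def restricted_wreath_def semidirect_product_def lamp_a_def
      lamp_x_def carrier_sum_group carrier_integer_mod_group PiE_iff)

lemma lamp_x_pow: "lamp_x [^]\<^bsub>lamplighter p\<^esub> (k::nat) = ((\<lambda>n. 0), int k)"
proof (induction k)
  case 0
  show ?case
    by (simp add: nat_pow_def lamplighter_def restricted_wreath_def semidirect_product_def
        restrict_UNIV fun_eq_iff)
next
  case (Suc k)
  have "lamp_x [^]\<^bsub>lamplighter p\<^esub> Suc k
      = lamp_x [^]\<^bsub>lamplighter p\<^esub> k \<otimes>\<^bsub>lamplighter p\<^esub> lamp_x"
    by (simp add: nat_pow_def)
  then show ?case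
    by (simp only: Suc)
      (simp add: lamplighter_def restricted_wreath_def semidirect_product_def lamp_x_def fun_eq_iff)
qed

lemma lamp_x_int_pow:
  assumes "1 < p"
  shows "lamp_x [^]\<^bsub>lamplighter p\<^esub> (k::int) = ((\<lambda>n. 0), k)"
proof -
  interpret G: group "lamplighter p" by (rule group_lamplighter)
  have *: "inv\<^bsub>lamplighter p\<^esub> ((\<lambda>n. 0), m) = ((\<lambda>n. 0), - m)" for m
  proof (rule G.inv_equality)
    have "((\<lambda>n. 0), m) \<in> carrier (lamplighter p)" for m
      using assms by (auto simp: lamplighter_def restricted_wreath_def semidirect_product_def
          carrier_sum_group carrier_integer_mod_group PiE_iff)
    then show "((\<lambda>n. 0), m) \<in> carrier (lamplighter p)" "((\<lambda>n. 0), - m) \<in> carrier (lamplighter p)"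
      by blast+
  qed (simp add: lamplighter_def restricted_wreath_def semidirect_product_def fun_eq_iff)
  show ?thesis
    by (simp add: int_pow_def2 lamp_x_pow *)
qed

text \<open>The conjugate \<open>x\<^sup>-\<^sup>n a x\<^sup>n\<close> is the generator of the \<open>n\<close>-th summand of the base group.\<close>

lemma lamp_conj:
  assumes "1 < p"
  shows "lamp_x [^]\<^bsub>lamplighter p\<^esub> (- n) \<otimes>\<^bsub>lamplighter p\<^esub> lamp_a
      \<otimes>\<^bsub>lamplighter p\<^esub> lamp_x [^]\<^bsub>lamplighter p\<^esub> (n::int)
    = ((\<lambda>m. if m = n then 1 else 0), 0)"
  using assms unfolding lamp_x_int_pow[OF assms]
  by (auto simp: lamplighter_def restricted_wreath_def semidirect_product_def lamp_a_def fun_eq_iff)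

lemma tree_edges_iff:
  "(v, w) \<in> tree_edges p \<longleftrightarrow> (\<exists>i<p. v \<in> tree_vertices p \<and> w = v @ [i])"
  by (auto simp: tree_edges_def)

lemma tree_vertices_simps [simp]:
  "[] \<in> tree_vertices p"
  "i # w \<in> tree_vertices p \<longleftrightarrow> i < p \<and> w \<in> tree_vertices p"
  "v @ w \<in> tree_vertices p \<longleftrightarrow> v \<in> tree_vertices p \<and> w \<in> tree_vertices p"
  by (auto simp: tree_vertices_def)

lemma group_tree_aut: "group (tree_aut p)"
proof (rule groupI)
  let ?V = "tree_vertices p"
  fix g h assume g: "g \<in> carrier (tree_aut p)" and h: "h \<in> carrier (tree_aut p)"
  have gV: "w \<in> ?V \<Longrightarrow> g w \<in> ?V" for w
    using g Bij_imp_funcset by (auto simp: tree_aut_def)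
  have "(v, w) \<in> tree_edges p \<longleftrightarrow> (h (g v), h (g w)) \<in> tree_edges p" if "v \<in> ?V" "w \<in> ?V" for v w
  proof -
    have "(v, w) \<in> tree_edges p \<longleftrightarrow> (g v, g w) \<in> tree_edges p"
      using g that unfolding tree_aut_def by simp
    also have "\<dots> \<longleftrightarrow> (h (g v), h (g w)) \<in> tree_edges p"
      using h gV[OF that(1)] gV[OF that(2)] unfolding tree_aut_def by simp
    finally show ?thesis .
  qed
  moreover have "compose ?V h g \<in> Bij ?V"
    using g h compose_Bij[of h ?V g] by (simp add: tree_aut_def)
  moreover have "g [] = []" "h [] = []"
    using g h by (simp_all add: tree_aut_def)
  ultimately show "g \<otimes>\<^bsub>tree_aut p\<^esub> h \<in> carrier (tree_aut p)"
    by (simp add: tree_aut_def compose_eq)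
next
  show "\<one>\<^bsub>tree_aut p\<^esub> \<in> carrier (tree_aut p)"
    by (simp add: tree_aut_def id_Bij)
next
  fix f g h
  assume f: "f \<in> carrier (tree_aut p)" and "g \<in> carrier (tree_aut p)" "h \<in> carrier (tree_aut p)"
  have "f \<in> tree_vertices p \<rightarrow> tree_vertices p"
    using f by (simp add: tree_aut_def Bij_imp_funcset)
  then show "f \<otimes>\<^bsub>tree_aut p\<^esub> g \<otimes>\<^bsub>tree_aut p\<^esub> h = f \<otimes>\<^bsub>tree_aut p\<^esub> (g \<otimes>\<^bsub>tree_aut p\<^esub> h)"
    by (simp add: tree_aut_def compose_assoc)
next
  fix g assume g: "g \<in> carrier (tree_aut p)"
  then show "\<one>\<^bsub>tree_aut p\<^esub> \<otimes>\<^bsub>tree_aut p\<^esub> g = g"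
    by (auto simp: tree_aut_def compose_def fun_eq_iff extensional_def dest: Bij_imp_extensional)
  let ?V = "tree_vertices p"
  let ?h = "\<lambda>w\<in>?V. inv_into ?V g w"
  have B: "g \<in> Bij ?V" using g by (simp add: tree_aut_def)
  have hB: "?h \<in> Bij ?V" by (rule restrict_inv_into_Bij[OF B])
  have hV: "?h w \<in> ?V" if "w \<in> ?V" for w using hB that Bij_imp_funcset by blast
  have gh: "g (?h w) = w" if "w \<in> ?V" for w
    using B that by (auto simp: Bij_def bij_betw_def f_inv_into_f)
  have hg: "?h (g w) = w" if "w \<in> ?V" for w
    using B that by (auto simp: Bij_def bij_betw_def)
  have hedge: "(v, w) \<in> tree_edges p \<longleftrightarrow> (?h v, ?h w) \<in> tree_edges p"
    if "v \<in> ?V" "w \<in> ?V" for v w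
  proof -
    have "(?h v, ?h w) \<in> tree_edges p \<longleftrightarrow> (g (?h v), g (?h w)) \<in> tree_edges p"
      using g hV[OF that(1)] hV[OF that(2)] unfolding tree_aut_def by simp
    then show ?thesis using gh that by simp
  qed
  have "?h [] = []"
  proof -
    have "g [] = []" using g by (simp add: tree_aut_def)
    then show ?thesis using hg[of "[]"] by simp
  qed
  then have "?h \<in> carrier (tree_aut p)"
    using hB hedge by (simp add: tree_aut_def)
  moreover have "?h \<otimes>\<^bsub>tree_aut p\<^esub> g = \<one>\<^bsub>tree_aut p\<^esub>"
    using gh by (auto simp: tree_aut_def compose_def intro!: restrict_ext)
  ultimately show "\<exists>y\<in>carrier (tree_aut p). y \<otimes>\<^bsub>tree_aut p\<^esub> g = \<one>\<^bsub>tree_aut p\<^esub>" by blast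
qed

lemma tree_autI:
  fixes f :: "nat list \<Rightarrow> nat list"
  assumes nil: "f [] = []"
    and snoc: "\<And>w i. w \<in> tree_vertices p \<Longrightarrow> i < p \<Longrightarrow> \<exists>k<p. f (w @ [i]) = f w @ [k]"
    and inj: "inj_on f (tree_vertices p)"
  shows "restrict f (tree_vertices p) \<in> carrier (tree_aut p)"
proof -
  let ?V = "tree_vertices p"
  have lev: "f w \<in> ?V \<and> length (f w) = length w" if "w \<in> ?V" for w
    using that
  proof (induction w rule: rev_induct)
    case (snoc i w)
    then show ?case using assms(2)[of w i] by auto
  qed (simp add: nil)
  have "w \<in> f ` ?V" if w: "w \<in> ?V" for w
  proof -
    let ?L = "{u \<in> ?V. length u = length w}"
    have "finite ?L"
      using finite_lists_length_eq[of "{..<p}" "length w"]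
      by (rule finite_subset[rotated]) (auto simp: tree_vertices_def)
    moreover have "f ` ?L \<subseteq> ?L" using lev by auto
    moreover have "inj_on f ?L" by (rule inj_on_subset[OF inj]) auto
    ultimately have "f ` ?L = ?L" by (simp add: endo_inj_surj)
    then show ?thesis using w by blast
  qed
  then have "bij_betw f ?V ?V" using inj lev by (auto simp: bij_betw_def)
  then have B: "restrict f ?V \<in> Bij ?V" by (simp add: Bij_def)
  have "(v, w) \<in> tree_edges p \<longleftrightarrow> (f v, f w) \<in> tree_edges p" if v: "v \<in> ?V" and w: "w \<in> ?V" for v w
  proof
    assume "(v, w) \<in> tree_edges p"
    then show "(f v, f w) \<in> tree_edges p"
      using snoc lev by (auto simp: tree_edges_iff)
  next
    assume "(f v, f w) \<in> tree_edges p"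
    then obtain k where k: "f w = f v @ [k]" by (auto simp: tree_edges_iff)
    then have "w \<noteq> []" using nil by auto
    then obtain u i where u: "w = u @ [i]" by (metis rev_exhaust)
    then have "u \<in> ?V" "i < p" using w by auto
    with snoc k u have "f u = f v" by fastforce
    then have "u = v" using inj \<open>u \<in> ?V\<close> v by (auto dest: inj_onD)
    then show "(v, w) \<in> tree_edges p" using u v \<open>i < p\<close> by (simp add: tree_edges_iff)
  qed
  with B nil show ?thesis by (simp add: tree_aut_def)
qed

lemma tree_aut_mult: "w \<in> tree_vertices p \<Longrightarrow> (g \<otimes>\<^bsub>tree_aut p\<^esub> h) w = h (g w)"
  by (simp add: tree_aut_def compose_eq)

lemma tree_aut_closed:
  assumes "g \<in> carrier (tree_aut p)" "w \<in> tree_vertices p"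
  shows "g w \<in> tree_vertices p"
  using assms Bij_imp_funcset by (auto simp: tree_aut_def)

lemma alpha_pow:
  assumes "w \<in> tree_vertices p"
  shows "(alpha p [^]\<^bsub>tree_aut p\<^esub> (n::nat)) w
    = (case w of [] \<Rightarrow> [] | i # u \<Rightarrow> ((i + n) mod p) # u)"
proof (induction n)
  case 0
  show ?case using assms
    by (cases w) (auto simp: nat_pow_def tree_aut_def)
next
  case (Suc n)
  have "(alpha p [^]\<^bsub>tree_aut p\<^esub> Suc n) w = alpha p ((alpha p [^]\<^bsub>tree_aut p\<^esub> n) w)"
    using assms by (simp add: nat_pow_def tree_aut_mult)
  also have "\<dots> = (case w of [] \<Rightarrow> [] | i # u \<Rightarrow> ((i + Suc n) mod p) # u)"
    unfolding Suc using assms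
    by (cases w) (auto simp: alpha_def rooted_aut_def wreath_aut_def tree_aut_def mod_Suc_eq)
  finally show ?case .
qed

lemma inj_add_mod:
  fixes a b i p :: nat
  assumes "(a + i) mod p = (b + i) mod p" "a < p" "b < p"
  shows "a = b"
proof -
  have *: "a \<le> b \<longrightarrow> a = b" if "(a + i) mod p = (b + i) mod p" "b < p" for a b :: nat
  proof
    assume "a \<le> b"
    then have "p dvd b - a"
      using that mod_eq_dvd_iff_nat[of "a + i" "b + i" p] by simp
    then show "a = b"
      using \<open>a \<le> b\<close> that(2) by (auto dest: dvd_imp_le)
  qed
  show ?thesis
    using *[of a b] *[of b a] assms by fastforce
qed

lemma inj_mult_mod:
  fixes a b j p :: nat
  assumes p: "prime p" and j: "j \<in> {1..p - 1}"
    and eq: "a * j mod p = b * j mod p" and ab: "a < p" "b < p"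
  shows "a = b"
proof -
  have j': "\<not> p dvd j" using j by (auto dest: dvd_imp_le)
  have *: "a \<le> b \<longrightarrow> a = b" if "a * j mod p = b * j mod p" "b < p" for a b :: nat
  proof
    assume "a \<le> b"
    then have "p dvd (b - a) * j"
      using that mod_eq_dvd_iff_nat[of "a * j" "b * j" p] by (simp add: diff_mult_distrib)
    then have "p dvd b - a" using p j' by (simp add: prime_dvd_mult_iff)
    then show "a = b"
      using \<open>a \<le> b\<close> that(2) by (auto dest: dvd_imp_le)
  qed
  show ?thesis
    using *[of a b] *[of b a] eq ab by fastforce
qed

lemma alpha_closed: "alpha p \<in> carrier (tree_aut p)"
proof -
  define f where "f w = (case w of [] \<Rightarrow> [] | i # u \<Rightarrow> ((i + 1) mod p) # u)" for w :: "nat list"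
  have "restrict f (tree_vertices p) \<in> carrier (tree_aut p)"
  proof (rule tree_autI)
    show "\<exists>k<p. f (w @ [i]) = f w @ [k]" if "w \<in> tree_vertices p" "i < p" for w i
      using that by (cases w) (auto simp: f_def)
    show "inj_on f (tree_vertices p)"
    proof (rule inj_onI)
      fix v w assume *: "v \<in> tree_vertices p" "w \<in> tree_vertices p" "f v = f w"
      show "v = w"
      proof (cases v)
        case Nil
        then show ?thesis using * by (cases w) (auto simp: f_def)
      next
        case (Cons a v')
        then obtain b w' where "w = b # w'" using * by (cases w) (auto simp: f_def)
        then show ?thesis
          using * Cons inj_add_mod[of a 1 p b] by (simp add: f_def)
      qed
    qed
  qed (simp add: f_def)
  moreover have "alpha p = restrict f (tree_vertices p)"
    by (auto simp: alpha_def rooted_aut_def wreath_aut_def f_def tree_aut_def restrict_def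
        fun_eq_iff split: list.splits)
  ultimately show ?thesis by simp
qed

lemma xi_equation_Cons:
  assumes "xi_equation p j \<xi>" "i # w \<in> tree_vertices p"
  shows "\<xi> (i # w) = beta p j i # (alpha p [^]\<^bsub>tree_aut p\<^esub> i) (\<xi> w)"
proof -
  have "\<xi> (i # w) = wreath_aut p (\<lambda>i. \<xi> \<otimes>\<^bsub>tree_aut p\<^esub> alpha p [^]\<^bsub>tree_aut p\<^esub> i) (beta p j) (i # w)"
    using assms(1) unfolding xi_equation_def by metis
  then show ?thesis using assms(2) by (simp add: wreath_aut_def tree_aut_mult)
qed

lemma ex1_xi:
  assumes p: "prime p" and j: "j \<in> {1..p - 1}"
  shows "\<exists>!\<xi>. \<xi> \<in> carrier (tree_aut p) \<and> xi_equation p j \<xi>"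
proof -
  let ?V = "tree_vertices p"
  define sh where "sh i w = (case w of [] \<Rightarrow> [] | k # u \<Rightarrow> ((k + i) mod p) # u)"
    for i :: nat and w :: "nat list"
  define f where "f = rec_list [] (\<lambda>i w r. (i * j mod p) # sh i r)"
  have f_simps: "f [] = []" "\<And>i w. f (i # w) = (i * j mod p) # sh i (f w)"
    by (simp_all add: f_def)
  have p0: "p > 0" using p by (simp add: prime_gt_0_nat)
  have shV: "sh i w \<in> ?V" if "w \<in> ?V" for i w
    using that p0 by (auto simp: sh_def split: list.splits)
  have fV: "f w \<in> ?V" if "w \<in> ?V" for w
    using that by (induction w) (auto simp: f_simps p0 shV)
  have sh_snoc: "\<exists>l<p. sh i (w @ [k]) = sh i w @ [l]" if "k < p" for i w k
    using that p0 by (cases w) (auto simp: sh_def)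
  have snoc: "\<exists>k<p. f (w @ [i]) = f w @ [k]" if "i < p" for w i
  proof (induction w)
    case Nil
    then show ?case using p0 by (simp add: f_simps sh_def)
  next
    case (Cons a w)
    then obtain k where "k < p" "f (w @ [i]) = f w @ [k]" by blast
    then show ?case using sh_snoc[of k a "f w"] by (auto simp: f_simps)
  qed
  have sh_inj: "v = w" if eq: "sh i v = sh i w" "v \<in> ?V" "w \<in> ?V" for i v w
  proof (cases v)
    case Nil
    then show ?thesis using eq by (cases w) (auto simp: sh_def)
  next
    case (Cons a v')
    then obtain b w' where "w = b # w'" using eq by (cases w) (auto simp: sh_def)
    then show ?thesis
      using eq Cons inj_add_mod[of a i p b] by (simp add: sh_def)
  qed
  have inj: "v = w" if "v \<in> ?V" "w \<in> ?V" "f v = f w" for v w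
    using that
  proof (induction v arbitrary: w)
    case Nil
    then show ?case by (cases w) (auto simp: f_simps)
  next
    case (Cons a v)
    then obtain b u where w: "w = b # u" by (cases w) (auto simp: f_simps)
    have ab: "a = b"
      using inj_mult_mod[OF p j, of a b] Cons.prems w by (simp add: f_simps)
    have "sh a (f v) = sh a (f u)" using Cons.prems w ab by (simp add: f_simps)
    moreover have "f v \<in> ?V" "f u \<in> ?V" using fV Cons.prems w by auto
    ultimately have "f v = f u" by (rule sh_inj)
    then show ?case using Cons w ab by auto
  qed
  let ?f = "restrict f ?V"
  have carr: "?f \<in> carrier (tree_aut p)"
    by (rule tree_autI) (auto simp: f_simps snoc inj intro: inj_onI)
  have eq: "xi_equation p j ?f"
    unfolding xi_equation_def
  proof
    fix w
    show "?f w = wreath_aut p (\<lambda>i. ?f \<otimes>\<^bsub>tree_aut p\<^esub> alpha p [^]\<^bsub>tree_aut p\<^esub> i) (beta p j) w"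
      by (cases w) (auto simp: wreath_aut_def restrict_def f_simps beta_def tree_aut_mult alpha_pow
          fV sh_def)
  qed
  show ?thesis
  proof (rule ex1I[of _ ?f])
    fix g assume g: "g \<in> carrier (tree_aut p) \<and> xi_equation p j g"
    have "g w = f w" if "w \<in> ?V" for w
      using that
    proof (induction w)
      case Nil
      then show ?case using g by (simp add: tree_aut_def f_simps)
    next
      case (Cons i w)
      then have "g (i # w) = beta p j i # (alpha p [^]\<^bsub>tree_aut p\<^esub> i) (f w)"
        using g xi_equation_Cons[of p j g i w] by simp
      then show ?case using Cons.prems by (simp add: f_simps beta_def alpha_pow fV sh_def)
    qed
    moreover have "g \<in> extensional ?V"
      using g by (auto simp: tree_aut_def Bij_def)
    ultimately show "g = ?f"
      by (auto simp: fun_eq_iff extensional_def)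
  qed (use carr eq in blast)
qed

lemma xi_closed:
  assumes "prime p" "j \<in> {1..p - 1}"
  shows "xi p j \<in> carrier (tree_aut p)" and "xi_equation p j (xi p j)"
  using theI'[OF ex1_xi[OF assms]] unfolding xi_def by blast+

end

theory Submission
  imports Defs "HOL-Computational_Algebra.Formal_Power_Series" "HOL-Number_Theory.Cong"
begin

text \<open>A word \<open>w\<^sub>0 w\<^sub>1 \<dots>\<close> is read as the power series \<open>\<Sum> w\<^sub>k t\<^sup>k\<close> over the field with \<open>p\<close> elements.
  Then \<open>\<alpha>\<close> is the translation by \<open>1\<close>, and the recursion for \<open>\<xi>\<close> says that \<open>\<xi>\<close> is multiplication by
  the unit \<open>s = j + t\<close>.  Hence \<open>(u, h)\<close> acts as \<open>w \<mapsto> (w + \<Sum> u\<^sub>n s\<^sup>n) s\<^sup>h\<close>, which is faithful because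
  the powers of \<open>s\<close> are linearly independent.  The state of \<open>w \<mapsto> (w + f) r\<close> at \<open>i\<close> is
  \<open>w \<mapsto> (w + g) r\<close> where \<open>t g r\<close> is \<open>(i + f) r\<close> without its constant term; \<open>g\<close> is again a Laurent
  polynomial in \<open>s\<close> because a Laurent polynomial in \<open>s\<close> without constant term is divisible by
  \<open>t = s - j\<close>.

  Residues are represented by integers, so series have integer coefficients and are compared
  modulo \<open>p\<close>.\<close>

unbundle fps_syntax

section \<open>Congruence of integral power series\<close>

definition fps_cong :: "int \<Rightarrow> int fps \<Rightarrow> int fps \<Rightarrow> bool"
  where "fps_cong m f g \<longleftrightarrow> (\<forall>n. [f $ n = g $ n] (mod m))"

lemma fps_cong_refl [simp, intro]: "fps_cong m f f"
  by (simp add: fps_cong_def)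

lemma fps_cong_sym: "fps_cong m f g \<Longrightarrow> fps_cong m g f"
  by (simp add: fps_cong_def cong_sym_eq)

lemma fps_cong_trans [trans]: "fps_cong m f g \<Longrightarrow> fps_cong m g h \<Longrightarrow> fps_cong m f h"
  unfolding fps_cong_def by (meson cong_trans)

lemma fps_cong_add: "fps_cong m f f' \<Longrightarrow> fps_cong m g g' \<Longrightarrow> fps_cong m (f + g) (f' + g')"
  by (simp add: fps_cong_def cong_add)

lemma fps_cong_diff: "fps_cong m f f' \<Longrightarrow> fps_cong m g g' \<Longrightarrow> fps_cong m (f - g) (f' - g')"
  by (simp add: fps_cong_def cong_diff)

lemma fps_cong_sum:
  "(\<And>i. i \<in> A \<Longrightarrow> fps_cong m (f i) (g i)) \<Longrightarrow> fps_cong m (sum f A) (sum g A)"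
  by (induction A rule: infinite_finite_induct) (auto intro: fps_cong_add)

lemma fps_cong_of_int: "[a = b] (mod m) \<Longrightarrow> fps_cong m (of_int a) (of_int b)"
  by (simp add: fps_cong_def)

text \<open>Coefficient \<open>n\<close> of a product involves only the coefficients up to
  \<open>n\<close> of its factors. The truncated form is what words require, since a word carries
  information only below its length.\<close>

lemma cong_fps_mult_nth:
  assumes "\<And>i. i \<le> n \<Longrightarrow> [f $ i = f' $ i] (mod m)" "\<And>i. i \<le> n \<Longrightarrow> [g $ i = g' $ i] (mod m)"
  shows "[(f * g) $ n = (f' * g') $ n] (mod m)"
  unfolding fps_mult_nth by (rule cong_sum) (auto intro!: cong_mult assms)

lemma fps_cong_mult: "fps_cong m f f' \<Longrightarrow> fps_cong m g g' \<Longrightarrow> fps_cong m (f * g) (f' * g')"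
  unfolding fps_cong_def by (blast intro: cong_fps_mult_nth)

lemmas fps_cong_intros = fps_cong_add fps_cong_diff fps_cong_mult

lemma fps_cong_mult_cancel:
  assumes "fps_cong m (r * r') 1" "fps_cong m (f * r) (g * r)"
  shows "fps_cong m f g"
proof -
  have *: "fps_cong m (h * r * r') h" for h
    using fps_cong_mult[OF fps_cong_refl assms(1), of h] by (simp add: mult.assoc)
  show ?thesis
    by (rule fps_cong_trans[OF fps_cong_sym[OF *] fps_cong_trans[OF _ *]])
      (rule fps_cong_mult[OF assms(2) fps_cong_refl])
qed


section \<open>Affine maps on words\<close>

definition word_fps :: "nat list \<Rightarrow> int fps"
  where "word_fps w = Abs_fps (\<lambda>k. if k < length w then int (w ! k) else 0)"

definition affine_act :: "nat \<Rightarrow> int fps \<Rightarrow> int fps \<Rightarrow> nat list \<Rightarrow> nat list"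
  where "affine_act p f r w =
    map (\<lambda>k. nat (((word_fps w + f) * r) $ k mod int p)) [0..<length w]"

lemma word_fps_nth: "word_fps w $ k = (if k < length w then int (w ! k) else 0)"
  by (simp add: word_fps_def)

lemma word_fps_Cons: "word_fps (i # w) = of_int (int i) + fps_X * word_fps w"
  by (rule fps_ext) (auto simp: word_fps_nth nth_Cons split: nat.splits)

lemma word_fps_replicate_0: "word_fps (replicate n 0) = 0"
  by (rule fps_ext) (simp add: word_fps_nth)

lemma length_affine_act [simp]: "length (affine_act p f r w) = length w"
  by (simp add: affine_act_def)

lemma affine_act_Nil [simp]: "affine_act p f r [] = []"
  by (simp add: affine_act_def)

lemma affine_act_nth:
  assumes "0 < p" "k < length w"
  shows "int (affine_act p f r w ! k) = ((word_fps w + f) * r) $ k mod int p"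
  using assms by (simp add: affine_act_def)

lemma affine_act_eqI:
  assumes "length v = length w"
    and "\<And>k. k < length w \<Longrightarrow>
      [((word_fps v + f) * r) $ k = ((word_fps w + g) * q) $ k] (mod int p)"
  shows "affine_act p f r v = affine_act p g q w"
  using assms by (auto simp: affine_act_def cong_def)

lemma affine_act_cong:
  assumes "fps_cong (int p) f g" "fps_cong (int p) r q"
  shows "affine_act p f r w = affine_act p g q w"
proof (rule affine_act_eqI)
  show "[((word_fps w + f) * r) $ k = ((word_fps w + g) * q) $ k] (mod int p)" for k
    using assms fps_cong_mult[OF fps_cong_add] fps_cong_refl unfolding fps_cong_def by blast
qed simp

lemma affine_act_in_tree_vertices:
  assumes "0 < p" shows "affine_act p f r w \<in> tree_vertices p"
  using assms by (auto simp: affine_act_def tree_vertices_def nat_less_iff)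

text \<open>Modulo \<open>p\<close> the second translation \<open>g\<close> equals
  \<open>g * r' * r\<close>, so the factor \<open>r\<close> can be pulled out of
  \<open>(w + f) * r + g\<close>. The reduced digits of the intermediate word agree with its series
  only below \<open>length w\<close>, hence the coefficientwise argument.\<close>

lemma affine_act_comp:
  assumes "0 < p" "fps_cong (int p) (r * r') 1"
  shows "affine_act p g q (affine_act p f r w) = affine_act p (f + g * r') (r * q) w"
proof (rule affine_act_eqI)
  fix k assume k: "k < length w"
  have "fps_cong (int p) (g * 1) (g * (r * r'))"
    by (rule fps_cong_mult[OF fps_cong_refl fps_cong_sym[OF assms(2)]])
  then have g: "[g $ i = (g * r' * r) $ i] (mod int p)" for i
    by (simp add: fps_cong_def ac_simps)
  have "[((word_fps (affine_act p f r w) + g) * q) $ k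
      = (((word_fps w + f) * r + g * r' * r) * q) $ k] (mod int p)"
    using k assms(1) by (intro cong_fps_mult_nth)
      (auto simp: word_fps_nth affine_act_nth intro!: cong_add[OF _ g])
  also have "((word_fps w + f) * r + g * r' * r) * q = (word_fps w + (f + g * r')) * (r * q)"
    by (simp add: algebra_simps)
  finally show "[((word_fps (affine_act p f r w) + g) * q) $ k
      = ((word_fps w + (f + g * r')) * (r * q)) $ k] (mod int p)" .
qed simp

lemma affine_act_id:
  assumes "w \<in> tree_vertices p"
  shows "affine_act p 0 1 w = w"
proof (rule nth_equalityI)
  fix k assume "k < length (affine_act p 0 1 w)"
  moreover from this have "w ! k < p" using assms by (auto simp: tree_vertices_def)
  ultimately show "affine_act p 0 1 w ! k = w ! k" by (simp add: affine_act_def word_fps_nth)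
qed simp

text \<open>The coefficients below \<open>length w\<close> do not see the appended letter. Prefixes
  are therefore preserved, which makes the map on series a map of the tree.\<close>

lemma affine_act_snoc:
  "affine_act p f r (w @ [i]) = affine_act p f r w
    @ [nat (((word_fps (w @ [i]) + f) * r) $ length w mod int p)]"
proof -
  have "((word_fps (w @ [i]) + f) * r) $ k = ((word_fps w + f) * r) $ k" if "k < length w" for k
    unfolding fps_mult_nth using that
    by (intro sum.cong) (auto simp: word_fps_nth nth_append)
  then show ?thesis by (simp add: affine_act_def)
qed

text \<open>Prefixing \<open>i\<close> turns the series of \<open>w\<close> into
  \<open>i + t w\<close>, and \<open>(i + t w + f) r = (i + f) r + t w r\<close>. The assumption
  rewrites this as \<open>c + t (w + g) r\<close>: \<open>c\<close> gives the new first letter, and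
  the section at \<open>i\<close> is affine with translation \<open>g\<close> and the same
  multiplier.\<close>

lemma affine_act_Cons:
  assumes "fps_cong (int p) ((of_int (int i) + f) * r) (of_int c + fps_X * (g * r))"
  shows "affine_act p f r (i # w) = nat (c mod int p) # affine_act p g r w"
proof -
  have "fps_cong (int p) ((of_int (int i) + f) * r + fps_X * word_fps w * r)
      (of_int c + fps_X * (g * r) + fps_X * word_fps w * r)"
    by (intro fps_cong_add assms fps_cong_refl)
  then have "fps_cong (int p) ((word_fps (i # w) + f) * r)
      (of_int c + fps_X * ((word_fps w + g) * r))"
    by (simp add: word_fps_Cons algebra_simps)
  then have "((word_fps (i # w) + f) * r) $ k mod int p
      = (of_int c + fps_X * ((word_fps w + g) * r)) $ k mod int p" for k
    by (simp add: fps_cong_def cong_def)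
  then show ?thesis
    unfolding affine_act_def
    by (simp add: upt_conv_Cons map_Suc_upt[symmetric] del: upt_Suc)
qed

section \<open>Affine maps as tree automorphisms\<close>

lemma affine_aut:
  assumes "0 < p" "fps_cong (int p) (r * r') 1"
  shows "restrict (affine_act p f r) (tree_vertices p) \<in> carrier (tree_aut p)"
proof (rule tree_autI)
  show "\<exists>k<p. affine_act p f r (w @ [i]) = affine_act p f r w @ [k]" for w i
    using assms(1) by (auto simp: affine_act_snoc nat_less_iff)
  \<comment> \<open>The inverse map is \<open>v \<mapsto> (v - f r) r'\<close>, which is
    \<open>v r' - f\<close> modulo \<open>p\<close>.\<close>
  have "affine_act p (- f * r) r' (affine_act p f r w) = w" if "w \<in> tree_vertices p" for w
  proof -
    have "affine_act p (- f * r) r' (affine_act p f r w)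
        = affine_act p (f + - f * r * r') (r * r') w"
      by (rule affine_act_comp[OF assms])
    also have "\<dots> = affine_act p 0 1 w"
      using fps_cong_diff[OF fps_cong_refl fps_cong_mult[OF fps_cong_refl assms(2)], of f f]
      by (intro affine_act_cong assms(2)) (simp add: ac_simps)
    finally show ?thesis by (simp add: affine_act_id that)
  qed
  then show "inj_on (affine_act p f r) (tree_vertices p)" by (rule inj_on_inverseI)
qed simp

text \<open>Zero words of all lengths reveal \<open>f * r\<close>, and words
  \<open>1 0 ... 0\<close> reveal \<open>(1 + f) * r\<close>. The difference of the two is
  \<open>r\<close>, and cancelling the unit \<open>r\<close> recovers \<open>f\<close>.\<close>

lemma affine_act_eq_imp_fps_cong:
  assumes p: "1 < p" and r: "fps_cong (int p) (r * r') 1"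
    and eq: "\<And>w. w \<in> tree_vertices p \<Longrightarrow> affine_act p f r w = affine_act p g q w"
  shows "fps_cong (int p) f g" "fps_cong (int p) r q"
proof -
  have nth: "[((word_fps w + f) * r) $ k = ((word_fps w + g) * q) $ k] (mod int p)"
    if "w \<in> tree_vertices p" "k < length w" for w k
  proof -
    have "int (affine_act p f r w ! k) = int (affine_act p g q w ! k)"
      using eq that by simp
    then show ?thesis using p that by (simp add: affine_act_nth cong_def)
  qed
  have V: "replicate n 0 \<in> tree_vertices p" for n
    using p by (auto simp: tree_vertices_def)
  have fg: "fps_cong (int p) (f * r) (g * q)"
    using nth[OF V, of _ "Suc _"] unfolding fps_cong_def
    by (metis add_0 length_replicate lessI word_fps_replicate_0)
  have "fps_cong (int p) ((1 + f) * r) ((1 + g) * q)"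
    unfolding fps_cong_def
  proof
    fix n
    have "word_fps (1 # replicate n 0) = 1"
      unfolding word_fps_Cons by (simp add: word_fps_replicate_0)
    then show "[((1 + f) * r) $ n = ((1 + g) * q) $ n] (mod int p)"
      using nth[of "1 # replicate n 0" n] V p by simp
  qed
  from fps_cong_diff[OF this fg] show rq: "fps_cong (int p) r q"
    by (simp add: algebra_simps)
  have "fps_cong (int p) (f * r) (g * r)"
    by (rule fps_cong_trans[OF fg fps_cong_mult[OF fps_cong_refl fps_cong_sym[OF rq]]])
  then show "fps_cong (int p) f g" by (rule fps_cong_mult_cancel[OF r])
qed

text \<open>Adding a constant changes only the constant coefficient, that is, the first
  letter.\<close>

lemma alpha_pow_eq_affine_act:
  assumes p: "1 < p" and w: "w \<in> tree_vertices p"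
  shows "(alpha p [^]\<^bsub>tree_aut p\<^esub> n) w = affine_act p (of_int (int n)) 1 w"
proof (cases w)
  case (Cons i u)
  have "affine_act p (of_int (int n)) 1 (i # u)
      = nat ((int i + int n) mod int p) # affine_act p 0 1 u"
    by (rule affine_act_Cons) simp
  also have "\<dots> = ((i + n) mod p) # u"
    using w Cons by (simp add: affine_act_id flip: of_nat_add of_nat_mod)
  finally show ?thesis using w Cons by (simp add: alpha_pow)
qed (simp add: alpha_pow)


section \<open>Laurent polynomials in \<open>j + t\<close>\<close>

text \<open>The inverse \<open>k\<close> of \<open>j\<close> modulo \<open>p\<close> is what makes
  \<open>j + t\<close> a unit.\<close>

locale linear_unit =
  fixes p j :: nat and k :: int
  assumes p_gt_1: "1 < p" and jk: "[int j * k = 1] (mod int p)"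
begin

abbreviation pcong :: "int fps \<Rightarrow> int fps \<Rightarrow> bool"  (infix "\<simeq>" 50)
  where "f \<simeq> g \<equiv> fps_cong (int p) f g"

definition s :: "int fps"
  where "s = of_int (int j) + fps_X"

text \<open>Since \<open>k (j + t) = 1 + k t\<close> modulo \<open>p\<close>, the geometric series \<open>k / (1 + k t)\<close> inverts \<open>s\<close>.\<close>

definition s_inv :: "int fps"
  where "s_inv = Abs_fps (\<lambda>n. k * (- k) ^ n)"

text \<open>The integer powers of \<open>s\<close> modulo \<open>p\<close>. Because
  \<open>s_inv\<close> is an inverse only modulo \<open>p\<close>, the exponent law is a
  congruence.\<close>

definition sp :: "int \<Rightarrow> int fps"
  where "sp n = (if 0 \<le> n then s ^ nat n else s_inv ^ nat (- n))"

lemma s_s_inv: "s * s_inv \<simeq> 1"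
  unfolding fps_cong_def
proof
  fix n
  have eq: "(s * s_inv) $ n = int j * (k * (- k) ^ n) + (if n = 0 then 0 else k * (- k) ^ (n - 1))"
    unfolding s_def s_inv_def
    by (simp add: distrib_right fps_of_int [symmetric])
  show "[(s * s_inv) $ n = 1 $ n] (mod int p)"
  proof (cases n)
    case 0
    then show ?thesis using jk eq by simp
  next
    case (Suc m)
    \<comment> \<open>Two neighbouring terms of the geometric series combine, leaving a factor that
      vanishes modulo \<open>p\<close>.\<close>
    have "(s * s_inv) $ n = (1 - int j * k) * (k * (- k) ^ m)"
      using Suc unfolding eq by (simp add: algebra_simps)
    moreover have "int p dvd 1 - int j * k"
      using jk by (metis cong_iff_dvd_diff cong_sym)
    ultimately show ?thesis using Suc by (simp add: cong_0_iff)
  qed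
qed

lemma sp_0 [simp]: "sp 0 = 1" and sp_1 [simp]: "sp 1 = s" and sp_minus_1 [simp]: "sp (- 1) = s_inv"
  by (simp_all add: sp_def)

lemma sp_plus_1: "sp (n + 1) \<simeq> s * sp n"
proof (cases "0 \<le> n")
  case True
  then show ?thesis by (simp add: sp_def nat_add_distrib)
next
  case False
  then have *: "nat (- n) = Suc (nat (- (n + 1)))" by simp
  \<comment> \<open>This also covers \<open>n = - 1\<close>: the two branches of \<open>sp\<close>
    agree at exponent \<open>0\<close>.\<close>
  have "sp (n + 1) = s_inv ^ nat (- (n + 1))"
    using False by (auto simp: sp_def)
  moreover have "s * sp n = s * s_inv * s_inv ^ nat (- (n + 1))"
    using False unfolding sp_def * by (simp only: if_False power_Suc mult.assoc)
  ultimately show ?thesis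
    using fps_cong_mult[OF fps_cong_sym[OF s_s_inv] fps_cong_refl, of "s_inv ^ nat (- (n + 1))"]
    by (simp only: mult_1_left)
qed

lemma sp_minus_1': "sp (n - 1) \<simeq> s_inv * sp n"
proof -
  have "s_inv * sp n \<simeq> s_inv * (s * sp (n - 1))"
    using sp_plus_1[of "n - 1"] by (intro fps_cong_mult fps_cong_refl) simp
  also have "\<dots> = s * s_inv * sp (n - 1)" by (simp add: ac_simps)
  also have "\<dots> \<simeq> 1 * sp (n - 1)" by (intro fps_cong_mult s_s_inv fps_cong_refl)
  finally show ?thesis by (simp add: fps_cong_sym)
qed

lemma sp_add: "sp (m + n) \<simeq> sp m * sp n"
proof (induction m rule: int_induct[of _ 0])
  case (step1 m)
  have "sp (m + 1 + n) \<simeq> s * sp (m + n)"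
    using sp_plus_1[of "m + n"] by (simp add: ac_simps)
  also have "\<dots> \<simeq> s * (sp m * sp n)" by (intro fps_cong_mult step1 fps_cong_refl)
  also have "\<dots> = s * sp m * sp n" by (simp add: ac_simps)
  also have "\<dots> \<simeq> sp (m + 1) * sp n"
    by (intro fps_cong_mult fps_cong_refl fps_cong_sym[OF sp_plus_1])
  finally show ?case .
next
  case (step2 m)
  have "sp (m - 1 + n) \<simeq> s_inv * sp (m + n)"
    using sp_minus_1'[of "m + n"] by (simp add: algebra_simps)
  also have "\<dots> \<simeq> s_inv * (sp m * sp n)" by (intro fps_cong_mult step2 fps_cong_refl)
  also have "\<dots> = s_inv * sp m * sp n" by (simp add: ac_simps)
  also have "\<dots> \<simeq> sp (m - 1) * sp n"
    by (intro fps_cong_mult fps_cong_refl fps_cong_sym[OF sp_minus_1'])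
  finally show ?case .
qed simp

lemma sp_inverse: "sp h * sp (- h) \<simeq> 1"
  using fps_cong_sym[OF sp_add[of h "- h"]] by simp

section \<open>Evaluation of Laurent polynomials at \<open>s\<close>\<close>

definition lau :: "(int \<Rightarrow> int) \<Rightarrow> int fps"
  where "lau c = (\<Sum>n | c n \<noteq> 0. of_int (c n) * sp n)"

abbreviation fin_supp :: "(int \<Rightarrow> int) \<Rightarrow> bool"
  where "fin_supp c \<equiv> finite {n. c n \<noteq> 0}"

lemma fin_supp_add: "fin_supp c \<Longrightarrow> fin_supp d \<Longrightarrow> fin_supp (\<lambda>n. c n + d n)"
  by (rule finite_subset[of _ "{n. c n \<noteq> 0} \<union> {n. d n \<noteq> 0}"]) auto

lemma fin_supp_cmult: "fin_supp c \<Longrightarrow> fin_supp (\<lambda>n. a * c n)"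
  by (rule finite_subset[of _ "{n. c n \<noteq> 0}"]) auto

lemma fin_supp_mod: "fin_supp c \<Longrightarrow> fin_supp (\<lambda>n. c n mod int p)"
  by (rule finite_subset[of _ "{n. c n \<noteq> 0}"]) auto

lemma supp_shift: "{n. c (n + h) \<noteq> 0} = (\<lambda>n. n - h) ` {n. c n \<noteq> (0::int)}" for h :: int
  by (auto simp: image_iff) (metis add_diff_cancel_right' diff_add_cancel)

lemma fin_supp_shift: "fin_supp c \<Longrightarrow> fin_supp (\<lambda>n. c (n + h))"
  by (simp add: supp_shift)

lemma fin_supp_single: "fin_supp (\<lambda>n. if n = m then a else 0)"
  by (rule finite_subset[of _ "{m}"]) auto

lemma lau_superset:
  assumes "finite A" "{n. c n \<noteq> 0} \<subseteq> A"
  shows "lau c = (\<Sum>n\<in>A. of_int (c n) * sp n)"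
  unfolding lau_def using assms by (intro sum.mono_neutral_left) auto

lemma lau_add:
  assumes "fin_supp c" "fin_supp d"
  shows "lau (\<lambda>n. c n + d n) = lau c + lau d"
proof -
  let ?A = "{n. c n \<noteq> 0} \<union> {n. d n \<noteq> 0}"
  have "lau (\<lambda>n. c n + d n) = (\<Sum>n\<in>?A. of_int (c n + d n) * sp n)"
    "lau c = (\<Sum>n\<in>?A. of_int (c n) * sp n)" "lau d = (\<Sum>n\<in>?A. of_int (d n) * sp n)"
    using assms by (auto simp del: of_int_add intro!: lau_superset)
  then show ?thesis by (simp only: of_int_add distrib_right sum.distrib)
qed

lemma lau_cmult:
  assumes "fin_supp c"
  shows "lau (\<lambda>n. a * c n) = of_int a * lau c"
proof -
  have "lau (\<lambda>n. a * c n) = (\<Sum>n | c n \<noteq> 0. of_int (a * c n) * sp n)"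
    using assms by (intro lau_superset) auto
  then show ?thesis by (simp add: lau_def sum_distrib_left mult.assoc)
qed

lemma lau_single: "lau (\<lambda>n. if n = m then a else 0) = of_int a * sp m"
  by (subst lau_superset[of "{m}"]) auto

lemma lau_mod:
  assumes "fin_supp c"
  shows "lau (\<lambda>n. c n mod int p) \<simeq> lau c"
proof -
  have "lau (\<lambda>n. c n mod int p) = (\<Sum>n | c n \<noteq> 0. of_int (c n mod int p) * sp n)"
    using assms by (intro lau_superset) auto
  also have "\<dots> \<simeq> lau c"
    unfolding lau_def by (intro fps_cong_sum fps_cong_mult fps_cong_of_int fps_cong_refl) simp
  finally show ?thesis .
qed

text \<open>Reindexing lowers every exponent by \<open>h\<close>. Thus the action of the infinite
  cyclic group on the base group becomes multiplication by a power of \<open>s\<close>.\<close>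

lemma lau_shift: "lau (\<lambda>n. c (n + h)) \<simeq> lau c * sp (- h)"
proof -
  have "lau (\<lambda>n. c (n + h)) = (\<Sum>n | c n \<noteq> 0. of_int (c n) * sp (n + - h))"
    unfolding lau_def supp_shift by (subst sum.reindex) (auto simp: inj_on_def)
  also have "\<dots> \<simeq> (\<Sum>n | c n \<noteq> 0. of_int (c n) * (sp n * sp (- h)))"
    by (intro fps_cong_sum fps_cong_mult fps_cong_refl sp_add)
  also have "\<dots> = lau c * sp (- h)"
    by (simp add: lau_def sum_distrib_right mult.assoc)
  finally show ?thesis .
qed

section \<open>Linear independence of the powers of \<open>s\<close> modulo \<open>p\<close>\<close>

lemma s_power_nth:
  "n \<le> m \<Longrightarrow> (s ^ n) $ m = (if m = n then 1 else 0)"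
proof (induction n arbitrary: m)
  case (Suc n)
  have "(s ^ Suc n) $ m = int j * (s ^ n) $ m + (fps_X * s ^ n) $ m"
    unfolding s_def by (simp add: distrib_right fps_of_int [symmetric])
  with Suc show ?case by (auto simp: Suc.IH)
qed auto

text \<open>After multiplication by a power of \<open>s\<close> all exponents are nonnegative, and then the coefficient
  of \<open>t\<close> in the largest degree comes only from the largest exponent, as \<open>s\<close> is monic in \<open>t\<close>.\<close>

lemma lau_eq_0:
  assumes c: "fin_supp c" and z: "lau c \<simeq> 0"
  shows "[c n = 0] (mod int p)"
proof (rule ccontr)
  \<comment> \<open>Coefficients are reduced first, so that the extreme exponents of the support
    have coefficients nonzero modulo \<open>p\<close>.\<close>
  let ?d = "\<lambda>n. c n mod int p"
  assume n: "\<not> [c n = 0] (mod int p)"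
  have d: "fin_supp ?d" by (rule fin_supp_mod[OF c])
  have ne: "{n. ?d n \<noteq> 0} \<noteq> {}" using n by (auto simp: cong_def)
  define M where "M = Max {n. ?d n \<noteq> 0}"
  define m where "m = Min {n. ?d n \<noteq> 0}"
  have M: "M \<in> {n. ?d n \<noteq> 0}" and m: "m \<in> {n. ?d n \<noteq> 0}"
    unfolding M_def m_def
    by (rule Max_in[OF d ne], rule Min_in[OF d ne])
  have le: "m \<le> i" "i \<le> M" if "?d i \<noteq> 0" for i
    using that d by (auto simp: M_def m_def)
  let ?e = "\<lambda>i. ?d (i + m)"
  have e: "fin_supp ?e" by (rule fin_supp_shift[OF d])
  have "lau ?e \<simeq> lau ?d * sp (- m)" by (rule lau_shift)
  also have "\<dots> \<simeq> lau c * sp (- m)" by (intro fps_cong_mult lau_mod c fps_cong_refl)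
  also have "\<dots> \<simeq> 0 * sp (- m)" by (intro fps_cong_mult z fps_cong_refl)
  finally have "[lau ?e $ nat (M - m) = 0] (mod int p)" by (simp add: fps_cong_def)
  moreover have "lau ?e $ nat (M - m) = ?d M"
  proof -
    have "(of_int (?e i) * sp i) $ nat (M - m) = (if i = M - m then ?d M else 0)"
      if "?e i \<noteq> 0" for i
    proof -
      have "0 \<le> i" "i \<le> M - m" using le[OF that] by auto
      then show ?thesis by (auto simp: sp_def s_power_nth fps_of_int [symmetric])
    qed
    then have "lau ?e $ nat (M - m) = (\<Sum>i | ?e i \<noteq> 0. if i = M - m then ?d M else 0)"
      unfolding lau_def fps_sum_nth by (intro sum.cong) auto
    also have "\<dots> = ?d M" using e M by (simp add: sum.delta)
    finally show ?thesis .
  qed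
  ultimately show False using M by (simp add: cong_def)
qed

text \<open>The quotient by t must again be a Laurent polynomial in \<open>s\<close>, since it has
  to come from an element of the base group. The induction runs in both directions and uses only
  \<open>s = j + t\<close> and the inverse of \<open>s\<close>.\<close>

lemma sp_split: "\<exists>e d. fin_supp d \<and> sp n \<simeq> of_int e + fps_X * lau d"
proof (induction n rule: int_induct[of _ 0])
  case base
  show ?case
    by (rule exI[of _ 1], rule exI[of _ "\<lambda>_. 0"]) (simp add: lau_def)
next
  case (step1 n)
  then obtain e d where d: "fin_supp d" and n: "sp n \<simeq> of_int e + fps_X * lau d" by blast
  \<comment> \<open>Here \<open>s (e + t D) = j e + t (e + D s)\<close>, where \<open>D\<close> is
    \<open>lau d\<close>; \<open>?d\<close> encodes \<open>e + D s\<close>.\<close>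
  let ?d = "\<lambda>n. (if n = 0 then e else 0) + d (n + - 1)"
  have fin: "fin_supp ?d" by (rule fin_supp_add[OF fin_supp_single fin_supp_shift[OF d]])
  have "sp (n + 1) \<simeq> s * sp n" by (rule sp_plus_1)
  also have "\<dots> \<simeq> s * (of_int e + fps_X * lau d)" by (intro fps_cong_mult n fps_cong_refl)
  also have "\<dots> = of_int (int j * e) + fps_X * (of_int e + lau d * s)"
    by (simp add: s_def algebra_simps)
  also have "\<dots> \<simeq> of_int (int j * e) + fps_X * (of_int e + lau (\<lambda>n. d (n + - 1)))"
    using fps_cong_sym[OF lau_shift[of d "- 1"]]
    by (intro fps_cong_add fps_cong_mult fps_cong_refl) simp
  also have "of_int e + lau (\<lambda>n. d (n + - 1)) = lau ?d"
    by (subst lau_add[OF fin_supp_single fin_supp_shift[OF d]]) (simp only: lau_single sp_0 mult_1_right)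
  finally show ?case
    using fin by (intro exI[of _ "int j * e"] exI[of _ ?d] conjI)
next
  case (step2 n)
  then obtain e d where d: "fin_supp d" and n: "sp n \<simeq> of_int e + fps_X * lau d" by blast
  \<comment> \<open>Multiplying \<open>j k = k s - k t\<close> by \<open>s_inv\<close> gives
    \<open>s_inv = k - t k s_inv\<close> modulo \<open>p\<close>. Hence
    \<open>s_inv (e + t D)\<close> has constant term \<open>e k\<close> and quotient
    \<open>- e k s_inv + D s_inv\<close>, which \<open>?d\<close> encodes.\<close>
  let ?d = "\<lambda>n. (if n = - 1 then - (e * k) else 0) + d (n + 1)"
  have fin: "fin_supp ?d" by (rule fin_supp_add[OF fin_supp_single fin_supp_shift[OF d]])
  have "1 \<simeq> of_int (int j * k)"
    using fps_cong_sym[OF fps_cong_of_int[OF jk]] by simp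
  then have "s_inv * 1 \<simeq> s_inv * of_int (int j * k)" by (intro fps_cong_mult fps_cong_refl)
  also have "\<dots> = of_int k * (s * s_inv) - fps_X * (of_int k * s_inv)"
    by (simp add: s_def algebra_simps)
  also have "\<dots> \<simeq> of_int k * 1 - fps_X * (of_int k * s_inv)"
    by (intro fps_cong_diff fps_cong_mult s_s_inv fps_cong_refl)
  finally have s_inv: "s_inv \<simeq> of_int k - fps_X * (of_int k * s_inv)" by simp
  have "sp (n - 1) \<simeq> s_inv * sp n" by (rule sp_minus_1')
  also have "\<dots> \<simeq> s_inv * (of_int e + fps_X * lau d)" by (intro fps_cong_mult n fps_cong_refl)
  also have "\<dots> = of_int e * s_inv + fps_X * (lau d * s_inv)"
    by (simp add: algebra_simps)
  also have "\<dots> \<simeq> of_int e * (of_int k - fps_X * (of_int k * s_inv)) + fps_X * lau (\<lambda>n. d (n + 1))"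
    using fps_cong_sym[OF lau_shift[of d 1]] s_inv
    by (intro fps_cong_add fps_cong_mult fps_cong_refl) auto
  also have "\<dots> = of_int (e * k) + fps_X * (of_int (- (e * k)) * sp (- 1) + lau (\<lambda>n. d (n + 1)))"
    by (simp add: algebra_simps)
  also have "of_int (- (e * k)) * sp (- 1) + lau (\<lambda>n. d (n + 1)) = lau ?d"
    by (subst lau_add[OF fin_supp_single fin_supp_shift[OF d]]) (simp only: lau_single)
  finally show ?case
    using fin by (intro exI[of _ "e * k"] exI[of _ ?d] conjI)
qed

lemma lau_split:
  assumes "fin_supp c"
  shows "\<exists>e d. fin_supp d \<and> lau c \<simeq> of_int e + fps_X * lau d"
proof -
  have "\<exists>e d. fin_supp d \<and> (\<Sum>n\<in>A. of_int (c n) * sp n) \<simeq> of_int e + fps_X * lau d"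
    if "finite A" for A
    using that
  proof (induction A)
    case empty
    show ?case
      by (rule exI[of _ 0], rule exI[of _ "\<lambda>_. 0"]) (simp add: lau_def)
  next
    case (insert n A)
    then obtain e d where d: "fin_supp d"
      and A: "(\<Sum>n\<in>A. of_int (c n) * sp n) \<simeq> of_int e + fps_X * lau d" by blast
    obtain e' d' where d': "fin_supp d'" and n: "sp n \<simeq> of_int e' + fps_X * lau d'"
      using sp_split by blast
    have "(\<Sum>n\<in>insert n A. of_int (c n) * sp n)
        \<simeq> of_int (c n) * (of_int e' + fps_X * lau d') + (of_int e + fps_X * lau d)"
      unfolding sum.insert[OF insert.hyps] by (intro fps_cong_add fps_cong_mult n A fps_cong_refl)
    also have "\<dots> = of_int (c n * e' + e) + fps_X * lau (\<lambda>m. c n * d' m + d m)"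
      unfolding lau_add[OF fin_supp_cmult[OF d'] d] lau_cmult[OF d']
      by (simp add: algebra_simps)
    finally show ?case
      using fin_supp_add[OF fin_supp_cmult[OF d'] d]
      by (intro exI[of _ "c n * e' + e"] exI[of _ "\<lambda>m. c n * d' m + d m"] conjI)
  qed
  then show ?thesis using assms by (simp add: lau_def)
qed


section \<open>The representation\<close>

definition rep :: "(int \<Rightarrow> int) \<times> int \<Rightarrow> nat list \<Rightarrow> nat list"
  where "rep g = restrict (affine_act p (lau (fst g)) (sp (snd g))) (tree_vertices p)"

lemma rep_apply: "w \<in> tree_vertices p \<Longrightarrow> rep (u, h) w = affine_act p (lau u) (sp h) w"
  by (simp add: rep_def)

lemma carrier_lamplighter:
  "(u, h) \<in> carrier (lamplighter p) \<longleftrightarrow> (\<forall>n. 0 \<le> u n \<and> u n < int p) \<and> fin_supp u"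
  using p_gt_1
  by (simp add: lamplighter_def restricted_wreath_def semidirect_product_def carrier_sum_group
      carrier_integer_mod_group PiE_iff)

lemma mult_lamplighter:
  "(u, h) \<otimes>\<^bsub>lamplighter p\<^esub> (v, l) = ((\<lambda>n. (u n + v (n + h)) mod int p), h + l)"
  by (simp add: lamplighter_def restricted_wreath_def semidirect_product_def restrict_UNIV)

lemma rep_closed: "rep g \<in> carrier (tree_aut p)"
  unfolding rep_def using p_gt_1 by (intro affine_aut[OF _ sp_inverse]) auto

text \<open>By \<open>affine_act_comp\<close> the second translation is divided by
  \<open>s^h\<close>, which is exactly the effect of the shift by \<open>h\<close> in the wreath
  product.\<close>

lemma rep_mult:
  assumes "(u, h) \<in> carrier (lamplighter p)" "(v, l) \<in> carrier (lamplighter p)"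
  shows "rep ((u, h) \<otimes>\<^bsub>lamplighter p\<^esub> (v, l)) = rep (u, h) \<otimes>\<^bsub>tree_aut p\<^esub> rep (v, l)"
proof
  fix w
  have fin: "fin_supp u" "fin_supp (\<lambda>n. v (n + h))"
    using assms fin_supp_shift by (auto simp: carrier_lamplighter)
  have "lau (\<lambda>n. (u n + v (n + h)) mod int p) \<simeq> lau (\<lambda>n. u n + v (n + h))"
    by (rule lau_mod[OF fin_supp_add[OF fin]])
  also have "\<dots> = lau u + lau (\<lambda>n. v (n + h))" by (rule lau_add[OF fin])
  also have "\<dots> \<simeq> lau u + lau v * sp (- h)" by (intro fps_cong_add lau_shift fps_cong_refl)
  finally have "affine_act p (lau (\<lambda>n. (u n + v (n + h)) mod int p)) (sp (h + l)) w
      = affine_act p (lau u + lau v * sp (- h)) (sp h * sp l) w"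
    by (rule affine_act_cong[OF _ sp_add])
  also have "\<dots> = affine_act p (lau v) (sp l) (affine_act p (lau u) (sp h) w)"
    using p_gt_1 by (simp add: affine_act_comp[OF _ sp_inverse])
  finally show "rep ((u, h) \<otimes>\<^bsub>lamplighter p\<^esub> (v, l)) w
      = (rep (u, h) \<otimes>\<^bsub>tree_aut p\<^esub> rep (v, l)) w"
    using p_gt_1 by (simp add: mult_lamplighter rep_def tree_aut_def compose_def
        affine_act_in_tree_vertices)
qed

lemma rep_hom: "rep \<in> hom (lamplighter p) (tree_aut p)"
  using rep_closed rep_mult by (auto simp: hom_def)

lemma inj_rep: "inj_on rep (carrier (lamplighter p))"
proof (rule inj_onI, clarify)
  fix u h v l
  assume u: "(u, h) \<in> carrier (lamplighter p)" and v: "(v, l) \<in> carrier (lamplighter p)"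
    and eq: "rep (u, h) = rep (v, l)"
  have "affine_act p (lau u) (sp h) w = affine_act p (lau v) (sp l) w"
    if "w \<in> tree_vertices p" for w
    using that eq by (metis rep_apply)
  note cong = affine_act_eq_imp_fps_cong[OF p_gt_1 sp_inverse this]
  have fin: "fin_supp u" "fin_supp v" using u v by (auto simp: carrier_lamplighter)
  \<comment> \<open>Linear independence is applied to the difference of the two Laurent
    polynomials.\<close>
  have eqI: "[c n = d n] (mod int p)" if "fin_supp c" "fin_supp d" "lau c \<simeq> lau d" for c d n
  proof -
    have "lau c + of_int (- 1) * lau d \<simeq> lau d + of_int (- 1) * lau d"
      by (intro fps_cong_add that(3) fps_cong_refl)
    then have "lau (\<lambda>n. c n + - 1 * d n) \<simeq> 0"
      using that(1,2) by (simp only: lau_add fin_supp_cmult lau_cmult) simp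
    from lau_eq_0[OF fin_supp_add[OF that(1) fin_supp_cmult[OF that(2)]] this, of n]
    show ?thesis by (simp add: cong_0_iff cong_iff_dvd_diff)
  qed
  have "u = v"
  proof
    fix n
    have "u n mod int p = v n mod int p"
      using eqI[OF fin cong(1)] by (simp add: cong_def)
    then show "u n = v n" using u v by (simp add: carrier_lamplighter)
  qed
  moreover have "h = l"
  proof (rule ccontr)
    assume "h \<noteq> l"
    \<comment> \<open>The multipliers \<open>s^h\<close> and \<open>s^l\<close> are Laurent
      polynomials with a single coefficient; they are compared at exponent \<open>h\<close>.\<close>
    then have "[1 = 0] (mod int p)"
      using eqI[OF fin_supp_single fin_supp_single, of h 1 l 1 h] cong(2) by (simp add: lau_single)
    then show False using p_gt_1 by (simp add: cong_def)
  qed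
  ultimately show "u = v \<and> h = l" by blast
qed

lemma section_at_rep:
  assumes u: "(u, h) \<in> carrier (lamplighter p)" and i: "i < p"
  shows "\<exists>v. (v, h) \<in> carrier (lamplighter p) \<and> section_at p (rep (u, h)) i = rep (v, h)"
proof -
  \<comment> \<open>The letter \<open>i\<close> joins the coefficient of \<open>s^0\<close>, so
    \<open>?c\<close> encodes \<open>i + u\<close>; its shift by \<open>- h\<close> encodes
    \<open>(i + u) s^h\<close>.\<close>
  let ?c = "\<lambda>n. (if n = 0 then int i else 0) + u n"
  have fu: "fin_supp u" using u by (simp add: carrier_lamplighter)
  have c: "fin_supp ?c" by (rule fin_supp_add[OF fin_supp_single fu])
  have lc: "lau ?c = of_int (int i) + lau u"
    by (subst lau_add[OF fin_supp_single fu]) (simp only: lau_single sp_0 mult_1_right)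
  obtain e d where d: "fin_supp d"
    and split: "lau (\<lambda>n. ?c (n + - h)) \<simeq> of_int e + fps_X * lau d"
    using lau_split[OF fin_supp_shift[OF c, of "- h"]] by (elim exE conjE) (rule that)
  \<comment> \<open>The shift by \<open>h\<close> divides by \<open>s^h\<close>, as the section has
    multiplier \<open>s^h\<close> and needs \<open>lau v * sp h\<close> congruent to
    \<open>lau d\<close>. Reduction modulo \<open>p\<close> puts \<open>v\<close> into the base
    group.\<close>
  define v where "v = (\<lambda>n. d (n + h) mod int p)"
  have dh: "fin_supp (\<lambda>n. d (n + h))" by (rule fin_supp_shift[OF d])
  have v: "(v, h) \<in> carrier (lamplighter p)"
    using p_gt_1 fin_supp_mod[OF dh] by (simp add: carrier_lamplighter v_def)
  have "lau v \<simeq> lau (\<lambda>n. d (n + h))" unfolding v_def by (rule lau_mod[OF dh])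
  also have "\<dots> \<simeq> lau d * sp (- h)" by (rule lau_shift)
  finally have "lau v * sp h \<simeq> lau d * sp (- h) * sp h" by (intro fps_cong_mult fps_cong_refl)
  also have "\<dots> = lau d * (sp h * sp (- h))" by (simp add: ac_simps)
  also have "\<dots> \<simeq> lau d * 1" by (intro fps_cong_mult sp_inverse fps_cong_refl)
  finally have vd: "lau v * sp h \<simeq> lau d" by simp
  have "(of_int (int i) + lau u) * sp h \<simeq> lau (\<lambda>n. ?c (n + - h))"
    using fps_cong_sym[OF lau_shift[of ?c "- h"]] unfolding lc by simp
  also note split
  also have "of_int e + fps_X * lau d \<simeq> of_int e + fps_X * (lau v * sp h)"
    by (intro fps_cong_add fps_cong_mult fps_cong_refl fps_cong_sym[OF vd])
  finally have "affine_act p (lau u) (sp h) (i # w)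
      = nat (e mod int p) # affine_act p (lau v) (sp h) w" for w
    by (rule affine_act_Cons)
  then have "section_at p (rep (u, h)) i = rep (v, h)"
    using i by (auto simp: section_at_def rep_def)
  with v show ?thesis by blast
qed

lemma state_closed_rep: "state_closed p (rep ` carrier (lamplighter p))"
proof -
  interpret group_hom "lamplighter p" "tree_aut p" rep
    using group_lamplighter group_tree_aut rep_hom
    by (simp add: group_hom_def group_hom_axioms_def)
  have "states p g \<subseteq> rep ` carrier (lamplighter p)" if "g \<in> rep ` carrier (lamplighter p)" for g
  proof
    fix f assume "f \<in> states p g"
    then show "f \<in> rep ` carrier (lamplighter p)"
    proof induction
      case (section_at f i)
      then obtain u h where "(u, h) \<in> carrier (lamplighter p)" "f = rep (u, h)" by auto
      then show ?case using section_at_rep[OF _ section_at.hyps(2)] by blast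
    qed (rule that)
  qed
  then show ?thesis by (simp add: state_closed_def img_is_subgroup)
qed

section \<open>The images of the two generators\<close>

lemma rep_lamp_a: "rep lamp_a = alpha p"
proof
  fix w
  interpret T: group "tree_aut p" by (rule group_tree_aut)
  have "lau (\<lambda>n. if n = 0 then 1 else 0) = of_int (int 1)"
    by (simp only: lau_single sp_0) simp
  then have "rep lamp_a w = alpha p w" if "w \<in> tree_vertices p"
    using alpha_pow_eq_affine_act[OF p_gt_1 that, of 1] that
    by (simp add: rep_def lamp_a_def T.nat_pow_Suc alpha_closed)
  then show "rep lamp_a w = alpha p w"
    by (cases "w \<in> tree_vertices p")
      (auto simp: rep_def alpha_def rooted_aut_def wreath_aut_def)
qed

text \<open>Since \<open>(i + t w) s = i j + t (w s + i)\<close>, the first letter goes to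
  \<open>i j\<close>, and the section at \<open>i\<close> is multiplication by \<open>s\<close>
  followed by adding \<open>i\<close>, as the recursion demands.\<close>

lemma xi_equation_rep: "xi_equation p j (rep lamp_x)"
  unfolding xi_equation_def
proof
  fix w
  have x: "rep lamp_x v = affine_act p 0 s v" if "v \<in> tree_vertices p" for v
    using that by (simp add: rep_def lamp_x_def lau_def)
  have Cons: "affine_act p 0 s (i # v)
      = beta p j i # (alpha p [^]\<^bsub>tree_aut p\<^esub> i) (affine_act p 0 s v)" for i v
  proof -
    have "(of_int (int i) + 0) * s = of_int (int i * int j) + fps_X * (of_int (int i) * 1)"
      by (simp add: s_def algebra_simps)
    \<comment> \<open>Inserting \<open>s * s_inv\<close> gives the shape required by
      \<open>affine_act_Cons\<close>: adding \<open>i\<close> after multiplication by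
      \<open>s\<close> is translation by \<open>i s_inv\<close> before it.\<close>
    also have "\<dots> \<simeq> of_int (int i * int j) + fps_X * (of_int (int i) * (s * s_inv))"
      by (intro fps_cong_add fps_cong_mult fps_cong_refl fps_cong_sym[OF s_s_inv])
    also have "\<dots> = of_int (int i * int j) + fps_X * (of_int (int i) * s_inv * s)"
      by (simp add: ac_simps)
    finally have "affine_act p 0 s (i # v)
        = nat (int i * int j mod int p) # affine_act p (of_int (int i) * s_inv) s v"
      by (rule affine_act_Cons)
    also have "affine_act p (of_int (int i) * s_inv) s v
        = affine_act p (of_int (int i)) 1 (affine_act p 0 s v)"
      using p_gt_1 by (simp add: affine_act_comp[OF _ s_s_inv])
    also have "\<dots> = (alpha p [^]\<^bsub>tree_aut p\<^esub> i) (affine_act p 0 s v)"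
      using p_gt_1 by (simp add: alpha_pow_eq_affine_act affine_act_in_tree_vertices)
    also have "nat (int i * int j mod int p) = beta p j i"
      by (simp add: beta_def flip: of_nat_mult of_nat_mod)
    finally show ?thesis .
  qed
  show "rep lamp_x w
      = wreath_aut p (\<lambda>i. rep lamp_x \<otimes>\<^bsub>tree_aut p\<^esub> alpha p [^]\<^bsub>tree_aut p\<^esub> i) (beta p j) w"
  proof (cases "w \<in> tree_vertices p")
    case True
    then show ?thesis
      by (cases w) (auto simp: wreath_aut_def x Cons tree_aut_mult)
  qed (auto simp: wreath_aut_def rep_def)
qed

end

theorem theorem3:
  fixes p j :: nat
  assumes "prime p" and "j \<in> {1..p - 1}"
  shows "\<exists>\<Phi>. faithful_state_closed_rep p (lamplighter p) \<Phi>
             \<and> \<Phi> lamp_a = alpha p \<and> \<Phi> lamp_x = xi p j"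
proof -
  have "\<not> p dvd j" using assms(2) by (auto dest: dvd_imp_le)
  then have "coprime (int j) (int p)"
    using prime_imp_coprime[OF assms(1)] by (simp add: coprime_commute)
  then obtain k where "[int j * k = 1] (mod int p)"
    using cong_solve_coprime_int by blast
  then interpret linear_unit p j k
    using prime_gt_1_nat[OF assms(1)] by unfold_locales
  \<comment> \<open>Both sides are automorphisms solving the recursion, which has a unique
    solution.\<close>
  have "rep lamp_x = xi p j"
    using ex1_xi[OF assms] xi_closed[OF assms] rep_closed xi_equation_rep by blast
  then show ?thesis
    using rep_hom inj_rep state_closed_rep rep_lamp_a
    unfolding faithful_state_closed_rep_def by blast
qed

end
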